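(* Let $\kappa\leq\lambda$ be infinite cardinals with $\kappa$ regular. Let $\delta$ be a regular (infinite) cardinal such that $\delta\leq\lambda$. Then there is a continuous weak $\delta$-measure space $({}^{\kappa}\lambda,\mathfrak{M},\mu)$ on ${}^{\kappa}\lambda$ with $\mathrm{supp}(\mu)={}^{\kappa}\lambda$ (with $\mu$ taking values in some positively totally ordered monoid $\mathbb{S}$ with an infinitary sum $\mathsf{Sum}$).
   Context: **Topology.** ${}^{\kappa}\lambda$ is the set of sequences of elements of $\lambda$ of length $\kappa$, with the bounded topology, generated by the cones $\mathbf{N}_s=\{x\in{}^{\kappa}\lambda\mid s\subseteq x\}$ for $s\in{}^{<\kappa}\lambda=\bigcup_{\alpha<\kappa}{}^{\alpha}\lambda$. **Monoids and sums.** A positively totally ordered monoid is $\mathbb{S}=(S,0,+,\leq)$ where $+$ is associative (not necessarily commutative) with neutral element $0$, $\leq$ is a total order, $a\leq b$ and $c\leq d$ imply $a+c\leq b+d$, $0$ is the minimum of $\leq$, and $S\neq\{0\}$. ${}^{<\mathrm{On}}\mathbb{S}$ is the class of all sequences of elements of $S$ of ordinal length; $\mathrm{lh}(s)$ is the length of $s$. An infinitary sum on $\mathbb{S}$ is a partial function $\mathsf{Sum}:{}^{<\mathrm{On}}\mathbb{S}\to\mathbb{S}$ such that: (S1) $\mathsf{Sum}(\emptyset)=0$ and $\mathsf{Sum}(s)=s_0+\dots+s_n$ for every non-empty finite $s=(s_i)_{i\leq n}\in\mathrm{dom}(\mathsf{Sum})$; (S2) (continuity) for all $s\in\mathrm{dom}(\mathsf{Sum})$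 of limit length, if $s\restriction\alpha\in\mathrm{dom}(\mathsf{Sum})$ for cofinally many $\alpha<\mathrm{lh}(s)$, then $\mathsf{Sum}(s)=\sup\{\mathsf{Sum}(s\restriction\alpha)\mid\alpha<\mathrm{lh}(s),\ s\restriction\alpha\in\mathrm{dom}(\mathsf{Sum})\}$. **Measures.** A weakly $\delta$-measurable space is a pair $(X,\mathfrak{M})$ where $X$ is a topological space and $\mathfrak{M}$ is a family of subsets of $X$ closed under unions of size $<\delta$ and containing all open subsets of $X$. A $\delta$-measure on it (with values in $(\mathbb{S},\mathsf{Sum})$) is a partial function $\mu:\mathscr{P}(X)\to\mathbb{S}$ with $\mathfrak{M}\subseteq\mathrm{dom}(\mu)$ such that: (M1) $\mu(\emptyset)=0$; (M2) $\mu(X)>0$; (M3) $A\subseteq B$ implies $\mu(A)\leq\mu(B)$ for all $A,B\in\mathfrak{M}$; (M4) for every family $(A_i)_{i<\gamma}$ of pairwise disjoint sets of $\mathfrak{M}$ of length an ordinal $\gamma<\delta$, we have $\langle\mu(A_i)\mid i<\gamma\rangle\in\mathrm{dom}(\mathsf{Sum})$ and $\mu(\bigcup_{i<\gamma}A_i)=\mathsf{Sum}(\langle\mu(A_i)\mid i<\gamma\rangle)$; (M5) for every $x\in X$ with $\{x\}\in\mathfrak{M}$ and every open local basis $\{A_i\mid i<\gamma\}$ at $x$ with $\gamma<\delta$, $\mu(\{x\})=\inf_{i<\gamma}\mu(A_i)$. Then $(X,\mathfrak{M},\mu)$ is called a weak $\delta$-measure space. It is continuous if $\{x\}\in\mathfrak{M}$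 and $\mu(\{x\})=0$ for every $x\in X$. The support of $\mu$ is $\mathrm{supp}(\mu)=X\setminus\bigcup\{O\mid O\text{ open},\ \mu(O)=0\}$. *)

theory Defs
  imports "HOL-Analysis.Abstract_Topology" "HOL-Algebra.Group" "HOL-Algebra.Order"
    "HOL-Library.Disjoint_Sets"
begin

unbundle cardinal_syntax

text \<open>
  Ordinals are given by well-orders as in the library's cardinal theory: an ordinal
  \<open>\<alpha> < r\<close> is an element \<open>a \<in> Field r\<close>, standing for the initial segment \<open>underS r a\<close>.
  Sequences are partial maps, so that extension of sequences is \<open>\<subseteq>\<^sub>m\<close> and
  restriction to a shorter length is \<open>|`\<close>. As \<open>\<lambda>\<close> is reserved, that cardinal
  is written \<open>\<Lambda>\<close>.
\<close>

definition seqs :: "'i rel \<Rightarrow> 'a set \<Rightarrow> ('i \<rightharpoonup> 'a) set" where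
  "seqs r A = {x. dom x = Field r \<and> ran x \<subseteq> A}"

definition seqs_below :: "'i rel \<Rightarrow> 'a set \<Rightarrow> ('i \<rightharpoonup> 'a) set" where
  "seqs_below r A = {s. \<exists>a \<in> Field r. dom s = underS r a \<and> ran s \<subseteq> A}"

definition cone :: "'k rel \<Rightarrow> 'l rel \<Rightarrow> ('k \<rightharpoonup> 'l) \<Rightarrow> ('k \<rightharpoonup> 'l) set" where
  "cone \<kappa> \<Lambda> s = {x \<in> seqs \<kappa> (Field \<Lambda>). s \<subseteq>\<^sub>m x}"

definition bounded_topology :: "'k rel \<Rightarrow> 'l rel \<Rightarrow> ('k \<rightharpoonup> 'l) topology" where
  "bounded_topology \<kappa> \<Lambda> = topology_generated_by (cone \<kappa> \<Lambda> ` seqs_below \<kappa> (Field \<Lambda>))"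


text \<open>
  The monoid operation, written additively in the mathematics, is the multiplication
  \<open>\<otimes>\<close> of the (not necessarily commutative) monoid \<open>M\<close>, and \<open>0\<close> is \<open>\<one>\<close>.
\<close>

locale pos_tot_ord_monoid = monoid M + total_order L
  for M :: "'s monoid" and L :: "'s gorder" +
  assumes carrier_eq: "carrier L = carrier M"
    and add_mono: "\<lbrakk>a \<in> carrier M; b \<in> carrier M; c \<in> carrier M; d \<in> carrier M;
      a \<sqsubseteq>\<^bsub>L\<^esub> b; c \<sqsubseteq>\<^bsub>L\<^esub> d\<rbrakk> \<Longrightarrow> a \<otimes>\<^bsub>M\<^esub> c \<sqsubseteq>\<^bsub>L\<^esub> b \<otimes>\<^bsub>M\<^esub> d"
    and zero_least: "least L \<one>\<^bsub>M\<^esub> (carrier M)"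
    and nontrivial: "carrier M \<noteq> {\<one>\<^bsub>M\<^esub>}"

text \<open>
  HOL has no type of all ordinals; their class is represented by a well-order \<open>\<Omega>\<close>, the
  sequences of ordinal length being those whose length is below \<open>\<Omega>\<close>. For \<open>s\<close> in
  \<open>seqs_below \<Omega> S\<close>, the restrictions of \<open>s\<close> to ordinals below its length are the maps
  \<open>s |` underS \<Omega> a\<close> with \<open>a \<in> dom s\<close>.
\<close>

locale infinitary_sum = pos_tot_ord_monoid M L
  for M :: "'s monoid" and L :: "'s gorder" +
  fixes \<Omega> :: "'i rel" and Sum :: "('i \<rightharpoonup> 's) \<rightharpoonup> 's"
  assumes well_order: "Well_order \<Omega>"
    and Sum_dom: "dom Sum \<subseteq> seqs_below \<Omega> (carrier M)"
    and Sum_ran: "ran Sum \<subseteq> carrier M"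
    and S1_empty: "Sum Map.empty = Some \<one>\<^bsub>M\<^esub>"
    and S1_finite: "\<lbrakk>s \<in> dom Sum; js \<noteq> []; set js = dom s;
        sorted_wrt (\<lambda>i j. (i, j) \<in> \<Omega> \<and> i \<noteq> j) js\<rbrakk>
      \<Longrightarrow> Sum s = Some (foldr (\<otimes>\<^bsub>M\<^esub>) (map (\<lambda>i. the (s i)) js) \<one>\<^bsub>M\<^esub>)"
    and S2: "\<lbrakk>s \<in> dom Sum; dom s \<noteq> {};
        \<forall>i \<in> dom s. \<exists>j \<in> dom s. (i, j) \<in> \<Omega> \<and> i \<noteq> j;
        \<forall>i \<in> dom s. \<exists>a \<in> dom s. (i, a) \<in> \<Omega> \<and> s |` underS \<Omega> a \<in> dom Sum\<rbrakk>
      \<Longrightarrow> least L (the (Sum s))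
        (Upper L {the (Sum (s |` underS \<Omega> a)) | a. a \<in> dom s \<and> s |` underS \<Omega> a \<in> dom Sum})"


text \<open>In the following, \<open>\<delta>\<close> is an infinite cardinal.\<close>

locale weakly_measurable_space =
  fixes \<delta> :: "'d rel" and X :: "'x topology" and \<MM> :: "'x set set"
  assumes sets_subset: "\<MM> \<subseteq> Pow (topspace X)"
    and Union_closed: "\<lbrakk>\<F> \<subseteq> \<MM>; |\<F>| <o \<delta>\<rbrakk> \<Longrightarrow> \<Union>\<F> \<in> \<MM>"
    and open_sets: "openin X U \<Longrightarrow> U \<in> \<MM>"

definition open_local_basis :: "'x topology \<Rightarrow> 'x \<Rightarrow> 'x set set \<Rightarrow> bool" where
  "open_local_basis X x \<B> \<longleftrightarrow> (\<forall>B \<in> \<B>. openin X B \<and> x \<in> B) \<and>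
     (\<forall>U. openin X U \<and> x \<in> U \<longrightarrow> (\<exists>B \<in> \<B>. B \<subseteq> U))"

text \<open>
  The assumption \<open>\<delta> \<le>o \<Omega>\<close> says that every ordinal below \<open>\<delta>\<close> is represented in \<open>\<Omega>\<close>. In
  \<open>M4\<close>, \<open>(\<mu> \<circ> F) |` underS \<Omega> g\<close> is the sequence of the values \<open>\<mu> (F i)\<close>
  of length \<open>g\<close>, and the equation says that both sides are defined and equal.
\<close>

locale weak_measure_space =
  infinitary_sum M L \<Omega> Sum + weakly_measurable_space \<delta> X \<MM>
  for M :: "'s monoid" and L :: "'s gorder" and \<Omega> :: "'i rel"
    and Sum :: "('i \<rightharpoonup> 's) \<rightharpoonup> 's"
    and \<delta> :: "'d rel" and X :: "'x topology" and \<MM> :: "'x set set" +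
  fixes \<mu> :: "'x set \<rightharpoonup> 's"
  assumes \<delta>_le_\<Omega>: "\<delta> \<le>o \<Omega>"
    and \<mu>_dom: "\<MM> \<subseteq> dom \<mu>" "dom \<mu> \<subseteq> Pow (topspace X)"
    and \<mu>_ran: "ran \<mu> \<subseteq> carrier M"
    and M1: "\<mu> {} = Some \<one>\<^bsub>M\<^esub>"
    and M2: "\<one>\<^bsub>M\<^esub> \<sqsubset>\<^bsub>L\<^esub> the (\<mu> (topspace X))"
    and M3: "\<lbrakk>A \<in> \<MM>; B \<in> \<MM>; A \<subseteq> B\<rbrakk> \<Longrightarrow> the (\<mu> A) \<sqsubseteq>\<^bsub>L\<^esub> the (\<mu> B)"
    and M4: "\<lbrakk>g \<in> Field \<Omega>; Restr \<Omega> (underS \<Omega> g) <o \<delta>;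
        \<forall>i \<in> underS \<Omega> g. F i \<in> \<MM>; disjoint_family_on F (underS \<Omega> g)\<rbrakk>
      \<Longrightarrow> (\<mu> \<circ> F) |` underS \<Omega> g \<in> dom Sum \<and>
          \<mu> (\<Union>i \<in> underS \<Omega> g. F i) = Sum ((\<mu> \<circ> F) |` underS \<Omega> g)"
    and M5: "\<lbrakk>x \<in> topspace X; {x} \<in> \<MM>; open_local_basis X x \<B>; |\<B>| <o \<delta>\<rbrakk>
      \<Longrightarrow> greatest L (the (\<mu> {x})) (Lower L {the (\<mu> B) | B. B \<in> \<B>})"

locale continuous_weak_measure_space = weak_measure_space +
  assumes continuous: "x \<in> topspace X \<Longrightarrow> {x} \<in> \<MM> \<and> \<mu> {x} = Some \<one>\<^bsub>M\<^esub>"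

definition measure_support :: "'s monoid \<Rightarrow> 'x topology \<Rightarrow> ('x set \<rightharpoonup> 's) \<Rightarrow> 'x set" where
  "measure_support M X \<mu> = topspace X - \<Union>{U. openin X U \<and> \<mu> U = Some \<one>\<^bsub>M\<^esub>}"

end

(* The values of the measure are the final segments of kappa, ordered by inclusion, and both the
   addition and the infinitary sum are unions, so that the supremum of any family exists and is its
   sum. For a in kappa, the sets whose elements have fewer than delta initial segments of length
   a + 1 form an ideal, closed under unions of size < delta since delta is regular. The measure of A
   is the set of all a for which A is not in this ideal. A cone of length > a has only one initial
   segment of length a + 1, so measures tend to 0 along every local basis; a cone of length a has
   lambda >= delta of them, so nonempty open sets have positive measure. *)

theory Submission
  imports Defs
begin

subsection \<open>Chains of sets as monoids with infinitary sums\<close>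

definition union_monoid :: "'a set set \<Rightarrow> 'a set monoid" where
  "union_monoid S = \<lparr>carrier = S, mult = (\<union>), one = {}\<rparr>"

definition inclusion_order :: "'a set set \<Rightarrow> 'a set gorder" where
  "inclusion_order S = \<lparr>carrier = S, eq = (=), le = (\<subseteq>)\<rparr>"

definition union_sum :: "'i rel \<Rightarrow> 'a set set \<Rightarrow> ('i \<rightharpoonup> 'a set) \<rightharpoonup> 'a set" where
  "union_sum \<Omega> S = (\<lambda>s. if s \<in> seqs_below \<Omega> S then Some (\<Union>(ran s)) else None)"

lemma union_monoid_simps [simp]:
  "carrier (union_monoid S) = S" "A \<otimes>\<^bsub>union_monoid S\<^esub> B = A \<union> B" "\<one>\<^bsub>union_monoid S\<^esub> = {}"
  by (simp_all add: union_monoid_def)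

lemma inclusion_order_simps [simp]:
  "carrier (inclusion_order S) = S" "(.=\<^bsub>inclusion_order S\<^esub>) = (=)"
  "A \<sqsubseteq>\<^bsub>inclusion_order S\<^esub> B \<longleftrightarrow> A \<subseteq> B"
  by (simp_all add: inclusion_order_def)

lemma dom_union_sum [simp]: "dom (union_sum \<Omega> S) = seqs_below \<Omega> S"
  by (auto simp: union_sum_def dom_def)

lemma union_sum_eq: "s \<in> seqs_below \<Omega> S \<Longrightarrow> union_sum \<Omega> S s = Some (\<Union>(ran s))"
  by (simp add: union_sum_def)

lemma foldr_Un: "foldr (\<union>) As {} = \<Union>(set As)"
  by (induction As) auto

text \<open>The chain condition makes inclusion a total order in which binary union is the maximum.
  Closure under arbitrary unions, the empty one included, supplies the zero \<open>{}\<close> and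
  all suprema.\<close>

locale Union_closed_chain =
  fixes S :: "'a set set"
  assumes chain: "A \<in> S \<Longrightarrow> B \<in> S \<Longrightarrow> A \<subseteq> B \<or> B \<subseteq> A"
    and Union_mem: "\<A> \<subseteq> S \<Longrightarrow> \<Union>\<A> \<in> S"
    and nontrivial: "S \<noteq> {{}}"
begin

lemma empty_mem: "{} \<in> S"
  using Union_mem[of "{}"] by simp

lemma pos_tot_ord_monoid: "pos_tot_ord_monoid (union_monoid S) (inclusion_order S)"
proof
  fix A B assume "A \<in> carrier (union_monoid S)" "B \<in> carrier (union_monoid S)"
  then show "A \<otimes>\<^bsub>union_monoid S\<^esub> B \<in> carrier (union_monoid S)"
    using Union_mem[of "{A, B}"] by simp
next
  show "least (inclusion_order S) \<one>\<^bsub>union_monoid S\<^esub> (carrier (union_monoid S))"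
    using empty_mem by (auto simp: least_def)
qed (use chain nontrivial empty_mem in auto)

lemma Union_least:
  assumes "\<A> \<subseteq> S"
  shows "least (inclusion_order S) (\<Union>\<A>) (Upper (inclusion_order S) \<A>)"
  using Union_mem[OF assms] assms by (fastforce simp: least_def Upper_def)

text \<open>A union depends only on the set of entries, which settles the finite sums. At limit
  lengths every entry already occurs in a proper initial segment, which gives continuity.\<close>

lemma infinitary_sum:
  assumes \<Omega>: "Well_order \<Omega>" "Field \<Omega> \<noteq> {}"
  shows "infinitary_sum (union_monoid S) (inclusion_order S) \<Omega> (union_sum \<Omega> S)"
proof -
  interpret pos_tot_ord_monoid "union_monoid S" "inclusion_order S"
    by (rule pos_tot_ord_monoid)
  interpret \<Omega>: wo_rel \<Omega>
    using \<Omega>(1) by (simp add: wo_rel_def)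
  show ?thesis
  proof
    show "ran (union_sum \<Omega> S) \<subseteq> carrier (union_monoid S)"
      unfolding ran_def[of "union_sum \<Omega> S"]
      by (auto simp: union_sum_def seqs_below_def Union_mem split: if_splits)
  next
    \<comment> \<open>The minimum of \<Omega> serves as length 0; without it the empty sequence
      would have no length below \<Omega>.\<close>
    have "underS \<Omega> (\<Omega>.minim (Field \<Omega>)) = {}"
      using \<Omega>(2) \<Omega>.minim_least[of "Field \<Omega>"] \<Omega>.ANTISYM
      by (auto simp: underS_def Field_def dest: antisymD)
    then have "Map.empty \<in> seqs_below \<Omega> S"
      using \<Omega>(2) \<Omega>.minim_in[of "Field \<Omega>"] by (auto simp: seqs_below_def)
    then show "union_sum \<Omega> S Map.empty = Some \<one>\<^bsub>union_monoid S\<^esub>"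
      by (simp add: union_sum_eq)
  next
    fix s js
    assume s: "s \<in> dom (union_sum \<Omega> S)" and js: "set js = dom s"
    have "ran s = (\<lambda>i. the (s i)) ` set js"
      unfolding js by (force simp: ran_def)
    then show "union_sum \<Omega> S s =
        Some (foldr (\<otimes>\<^bsub>union_monoid S\<^esub>) (map (\<lambda>i. the (s i)) js) \<one>\<^bsub>union_monoid S\<^esub>)"
      using s by (simp add: union_sum_eq foldr_Un union_monoid_def)
  next
    fix s
    assume s: "s \<in> dom (union_sum \<Omega> S)"
      and lim: "\<forall>i \<in> dom s. \<exists>j \<in> dom s. (i, j) \<in> \<Omega> \<and> i \<noteq> j"
      and cof: "\<forall>i \<in> dom s. \<exists>a \<in> dom s. (i, a) \<in> \<Omega> \<and> s |` underS \<Omega> a \<in> dom (union_sum \<Omega> S)"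
    define \<A> where "\<A> = {the (union_sum \<Omega> S (s |` underS \<Omega> a)) | a.
      a \<in> dom s \<and> s |` underS \<Omega> a \<in> dom (union_sum \<Omega> S)}"
    have \<A>: "\<A> = {\<Union>(ran (s |` underS \<Omega> a)) | a. a \<in> dom s \<and> s |` underS \<Omega> a \<in> seqs_below \<Omega> S}"
      unfolding \<A>_def dom_union_sum by (simp add: union_sum_eq cong: rev_conj_cong)
    have "\<A> \<subseteq> S"
      unfolding \<A> by (auto simp: seqs_below_def intro!: Union_mem)
    moreover have "\<Union>(ran s) = \<Union>\<A>"
    proof
      show "\<Union>(ran s) \<subseteq> \<Union>\<A>"
      proof
        fix x assume "x \<in> \<Union>(ran s)"
        then obtain i where i: "i \<in> dom s" "x \<in> the (s i)"
          by (force simp: ran_def)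
        \<comment> \<open>\<open>cof\<close> only yields some a that is at least the given index.
          Passing first to a strictly larger j makes i < j and j at most a, so i lies strictly below
          a.\<close>
        obtain j where j: "j \<in> dom s" "(i, j) \<in> \<Omega>" "i \<noteq> j"
          using lim i(1) by blast
        obtain a where a: "a \<in> dom s" "(j, a) \<in> \<Omega>" "s |` underS \<Omega> a \<in> seqs_below \<Omega> S"
          using cof j(1) by auto
        have "i \<in> underS \<Omega> a"
          using j a \<Omega>.TRANS \<Omega>.ANTISYM unfolding underS_def
          by (auto dest: transD antisymD)
        then have "the (s i) \<in> ran (s |` underS \<Omega> a)"
          using i(1) by (auto simp: ran_def restrict_map_def)
        then show "x \<in> \<Union>\<A>"
          unfolding \<A> using a i(2) by blast
      qed
      show "\<Union>\<A> \<subseteq> \<Union>(ran s)"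
        unfolding \<A> by (force simp: ran_def restrict_map_def split: if_splits)
    qed
    ultimately show "least (inclusion_order S) (the (union_sum \<Omega> S s)) (Upper (inclusion_order S)
        {the (union_sum \<Omega> S (s |` underS \<Omega> a)) | a.
          a \<in> dom s \<and> s |` underS \<Omega> a \<in> dom (union_sum \<Omega> S)})"
      unfolding \<A>_def[symmetric] using s Union_least by (simp add: union_sum_eq)
  qed (use \<Omega> in auto)
qed

end

subsection \<open>The bounded topology\<close>

lemma restrict_mem_seqs_below:
  assumes "x \<in> seqs \<kappa> A" "a \<in> Field \<kappa>"
  shows "x |` underS \<kappa> a \<in> seqs_below \<kappa> A"
proof -
  have "underS \<kappa> a \<subseteq> Field \<kappa>"
    by (auto simp: underS_def Field_def)
  then have "dom (x |` underS \<kappa> a) = underS \<kappa> a"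
    using assms(1) by (auto simp: seqs_def)
  moreover have "ran (x |` underS \<kappa> a) \<subseteq> A"
    using assms(1) by (auto simp: seqs_def ran_def restrict_map_def split: if_splits)
  ultimately show ?thesis
    using assms(2) unfolding seqs_below_def by blast
qed

lemma map_restrict_le: "x |` A \<subseteq>\<^sub>m x"
  by (simp add: map_le_def)

lemma openin_cone:
  "x \<in> seqs \<kappa> (Field \<Lambda>) \<Longrightarrow> a \<in> Field \<kappa> \<Longrightarrow>
    openin (bounded_topology \<kappa> \<Lambda>) (cone \<kappa> \<Lambda> (x |` underS \<kappa> a))"
  unfolding bounded_topology_def
  by (intro topology_generated_by_Basis imageI restrict_mem_seqs_below)

lemma mem_cone: "x \<in> seqs \<kappa> (Field \<Lambda>) \<Longrightarrow> x \<in> cone \<kappa> \<Lambda> (x |` A)"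
  by (simp add: cone_def map_restrict_le)

lemma topspace_bounded_topology:
  assumes "Field \<kappa> \<noteq> {}"
  shows "topspace (bounded_topology \<kappa> \<Lambda>) = seqs \<kappa> (Field \<Lambda>)"
proof -
  obtain a where "a \<in> Field \<kappa>"
    using assms by blast
  then show ?thesis
    unfolding bounded_topology_def topology_generated_by_topspace
    using mem_cone restrict_mem_seqs_below by (fastforce simp: cone_def)
qed

text \<open>The generating cones behave like a base: of two cones given by initial segments of the
  same x, the longer segment gives the smaller cone, so the intersection case is a comparison of
  lengths.\<close>

lemma openin_bounded_topology_cone:
  assumes \<kappa>: "Well_order \<kappa>" "Field \<kappa> \<noteq> {}"
    and "openin (bounded_topology \<kappa> \<Lambda>) U" "x \<in> U"
  obtains a where "a \<in> Field \<kappa>" "cone \<kappa> \<Lambda> (x |` underS \<kappa> a) \<subseteq> U"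
proof -
  interpret \<kappa>: wo_rel \<kappa>
    using \<kappa>(1) by (simp add: wo_rel_def)
  have "generate_topology_on (cone \<kappa> \<Lambda> ` seqs_below \<kappa> (Field \<Lambda>)) U"
    using assms(3) by (simp add: bounded_topology_def openin_topology_generated_by_iff)
  then have "\<forall>x\<in>U. \<exists>a\<in>Field \<kappa>. cone \<kappa> \<Lambda> (x |` underS \<kappa> a) \<subseteq> U"
  proof induction
    case Empty
    show ?case by simp
  next
    case (Int U V)
    show ?case
    proof
      fix x assume "x \<in> U \<inter> V"
      then obtain a b where ab: "a \<in> Field \<kappa>" "cone \<kappa> \<Lambda> (x |` underS \<kappa> a) \<subseteq> U"
        "b \<in> Field \<kappa>" "cone \<kappa> \<Lambda> (x |` underS \<kappa> b) \<subseteq> V"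
        using Int.IH by blast
      have mono: "cone \<kappa> \<Lambda> (x |` underS \<kappa> d) \<subseteq> cone \<kappa> \<Lambda> (x |` underS \<kappa> c)"
        if "(c, d) \<in> \<kappa>" for c d
      proof -
        have "x |` underS \<kappa> c \<subseteq>\<^sub>m x |` underS \<kappa> d"
          using underS_incr[OF \<kappa>.TRANS \<kappa>.ANTISYM that]
          by (auto simp: map_le_def restrict_map_def)
        then show ?thesis
          by (auto simp: cone_def intro: map_le_trans)
      qed
      have "(a, b) \<in> \<kappa> \<or> (b, a) \<in> \<kappa>"
        using ab \<kappa>.TOTALS by blast
      then show "\<exists>a\<in>Field \<kappa>. cone \<kappa> \<Lambda> (x |` underS \<kappa> a) \<subseteq> U \<inter> V"
        using ab mono by blast
    qed
  next
    case (UN K)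
    then show ?case by blast
  next
    case (Basis U)
    then obtain s a where s: "U = cone \<kappa> \<Lambda> s" "a \<in> Field \<kappa>" "dom s = underS \<kappa> a"
      by (auto simp: seqs_below_def)
    \<comment> \<open>Every point of the cone of s restricts to s on \<open>dom s\<close>, so this
      cone is given by an initial segment of each of its points.\<close>
    have "x |` underS \<kappa> a = s" if "x \<in> U" for x
    proof
      fix i
      show "(x |` underS \<kappa> a) i = s i"
        using that s(1) domIff[of i s] unfolding s(3)
        by (auto simp: cone_def map_le_def restrict_map_def s(3))
    qed
    then show ?case
      using s by blast
  qed
  then show thesis
    using assms(4) that by blast
qed

subsection \<open>The measure\<close>

text \<open>\<open>under\<close> includes a itself, so restrictions have length a + 1 and show the
  value at a. A cone given by a sequence of length a thus branches at index a, whereas all its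
  points agree on \<open>underS\<close>.\<close>

definition thick :: "'k rel \<Rightarrow> 'd rel \<Rightarrow> ('k \<rightharpoonup> 'l) set \<Rightarrow> 'k set" where
  "thick \<kappa> \<delta> A = {a \<in> Field \<kappa>. \<not> |(\<lambda>x. x |` under \<kappa> a) ` A| <o \<delta>}"

lemma thick_subset: "thick \<kappa> \<delta> A \<subseteq> Field \<kappa>"
  by (auto simp: thick_def)

lemma thick_mono: "A \<subseteq> B \<Longrightarrow> thick \<kappa> \<delta> A \<subseteq> thick \<kappa> \<delta> B"
  unfolding thick_def by (auto dest: ordLeq_ordLess_trans[OF card_of_mono1[OF image_mono]])

text \<open>Restriction to \<open>under\<close> of a factors through restriction to
  \<open>under\<close> of b, so the restrictions at b are at least as many as those at a. Hence the
  values of the measure are final segments.\<close>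

lemma thick_upward:
  assumes "Well_order \<kappa>" "a \<in> thick \<kappa> \<delta> A" "(a, b) \<in> \<kappa>"
  shows "b \<in> thick \<kappa> \<delta> A"
proof -
  have "under \<kappa> a \<subseteq> under \<kappa> b"
    using assms(1,3) by (auto simp: under_def order_on_defs dest: transD)
  then have "(\<lambda>x. x |` under \<kappa> a) ` A = (\<lambda>x. x |` under \<kappa> a) ` (\<lambda>x. x |` under \<kappa> b) ` A"
    by (simp add: image_image Int_absorb1 Int_absorb2)
  then have "|(\<lambda>x. x |` under \<kappa> a) ` A| \<le>o |(\<lambda>x. x |` under \<kappa> b) ` A|"
    by (simp only: card_of_image)
  then show ?thesis
    using assms(2,3) by (auto simp: thick_def Field_def dest: ordLeq_ordLess_trans)
qed

text \<open>Behind the additivity of the measure: images commute with unions, and by stability fewer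
  than \<delta> sets of size below \<delta> have a union of size below \<delta>. The converse
  inclusion is monotonicity.\<close>

lemma thick_UNION:
  assumes "stable \<delta>" "|I| <o \<delta>"
  shows "thick \<kappa> \<delta> (\<Union>i\<in>I. F i) = (\<Union>i\<in>I. thick \<kappa> \<delta> (F i))"
proof
  show "thick \<kappa> \<delta> (\<Union>i\<in>I. F i) \<subseteq> (\<Union>i\<in>I. thick \<kappa> \<delta> (F i))"
    using stable_UNION[OF assms] by (force simp: thick_def image_UN)
  show "(\<Union>i\<in>I. thick \<kappa> \<delta> (F i)) \<subseteq> thick \<kappa> \<delta> (\<Union>i\<in>I. F i)"
    by (intro UN_least thick_mono) blast
qed

lemma singleton_ordLess_Cinfinite: "Cinfinite r \<Longrightarrow> |{x}| <o r"
  using card_of_Well_order[of "{x}"]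
  by (intro finite_ordLess_infinite) (auto simp: cinfinite_def card_order_on_def Field_card_of)

text \<open>The form with a common restriction s covers points, the empty set and subsets of
  sufficiently long cones at once.\<close>

lemma thick_eq_image_singleton:
  assumes "Cinfinite \<delta>" "\<And>x. x \<in> A \<Longrightarrow> x |` under \<kappa> a = s"
  shows "a \<notin> thick \<kappa> \<delta> A"
proof -
  have "|(\<lambda>x. x |` under \<kappa> a) ` A| \<le>o |{s}|"
    using assms(2) by (intro card_of_mono1) auto
  then have "|(\<lambda>x. x |` under \<kappa> a) ` A| <o \<delta>"
    using singleton_ordLess_Cinfinite[OF assms(1)] by (rule ordLeq_ordLess_trans)
  then show ?thesis
    by (simp add: thick_def)
qed

lemma thick_singleton: "Cinfinite \<delta> \<Longrightarrow> thick \<kappa> \<delta> {x} = {}"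
  using thick_eq_image_singleton[where A = "{x}"] by blast

lemma thick_empty: "Cinfinite \<delta> \<Longrightarrow> thick \<kappa> \<delta> {} = {}"
  using thick_eq_image_singleton[where A = "{}"] by fastforce

text \<open>Change the value of x at a alone. Since a is outside \<open>underS\<close>, the result
  stays in the cone; since a is inside \<open>under\<close>, different values give different
  restrictions. So there are at least as many restrictions as elements of \<Lambda>.\<close>

lemma thick_cone:
  assumes "Well_order \<kappa>" "Card_order \<Lambda>" "\<delta> \<le>o \<Lambda>"
    and x: "x \<in> seqs \<kappa> (Field \<Lambda>)" and a: "a \<in> Field \<kappa>"
  shows "a \<in> thick \<kappa> \<delta> (cone \<kappa> \<Lambda> (x |` underS \<kappa> a))"
proof -
  define f where "f l = x(a \<mapsto> l)" for l
  have "f l \<in> cone \<kappa> \<Lambda> (x |` underS \<kappa> a)" if "l \<in> Field \<Lambda>" for l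
    using x a that by (force simp: f_def cone_def seqs_def map_le_def underS_def ran_def)
  moreover have "a \<in> under \<kappa> a"
    using assms(1) a by (auto simp: under_def order_on_defs refl_on_def)
  then have "inj_on (\<lambda>l. f l |` under \<kappa> a) (Field \<Lambda>)"
    by (auto simp: inj_on_def f_def restrict_map_def fun_eq_iff split: if_splits)
  ultimately have "|Field \<Lambda>| \<le>o |(\<lambda>x. x |` under \<kappa> a) ` cone \<kappa> \<Lambda> (x |` underS \<kappa> a)|"
    by (intro card_of_ordLeq[THEN iffD1] exI[of _ "\<lambda>l. f l |` under \<kappa> a"]) auto
  then have "\<delta> \<le>o |(\<lambda>x. x |` under \<kappa> a) ` cone \<kappa> \<Lambda> (x |` underS \<kappa> a)|"
    using assms(2,3) by (meson card_of_Field_ordIso ordIso_symmetric ordLeq_ordIso_trans ordLeq_transitive)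
  then show ?thesis
    using a by (auto simp: thick_def dest: not_ordLess_ordLeq)
qed

section \<open>Final segments of \<kappa> as values of the measure\<close>

text \<open>
  The values of the measure are sets of partial maps rather than sets of indices, so an index is
  encoded as a map defined only there.
\<close>

definition tag :: "'k \<Rightarrow> ('k \<rightharpoonup> 'l)" where
  "tag a = [a \<mapsto> undefined]"

text \<open>The domain of \<open>tag a\<close> is the singleton of a, whatever value
  \<open>undefined\<close> stands for.\<close>

lemma inj_tag: "inj tag"
  by (auto simp: tag_def inj_def fun_eq_iff split: if_splits)

definition final_segments :: "'k rel \<Rightarrow> ('k \<rightharpoonup> 'l) set set" where
  "final_segments \<kappa> = image tag ` {U. U \<subseteq> Field \<kappa> \<and> (\<forall>a\<in>U. \<forall>b. (a, b) \<in> \<kappa> \<longrightarrow> b \<in> U)}"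

lemma Union_closed_chain_final_segments:
  assumes "Well_order \<kappa>" "Field \<kappa> \<noteq> {}"
  shows "Union_closed_chain (final_segments \<kappa> :: ('k \<rightharpoonup> 'l) set set)"
proof
  interpret \<kappa>: wo_rel \<kappa>
    using assms(1) by (simp add: wo_rel_def)
  fix A B :: "('k \<rightharpoonup> 'l) set"
  assume "A \<in> final_segments \<kappa>" "B \<in> final_segments \<kappa>"
  then obtain U V where UV: "A = tag ` U" "B = tag ` V"
    "U \<subseteq> Field \<kappa>" "\<forall>a\<in>U. \<forall>b. (a, b) \<in> \<kappa> \<longrightarrow> b \<in> U"
    "V \<subseteq> Field \<kappa>" "\<forall>a\<in>V. \<forall>b. (a, b) \<in> \<kappa> \<longrightarrow> b \<in> V"
    by (auto simp: final_segments_def)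
  \<comment> \<open>If a is in U but not in V and b is in V but not in U, then the larger of the two
    would lie in both by upward closure.\<close>
  then have "U \<subseteq> V \<or> V \<subseteq> U"
    using \<kappa>.TOTALS by blast
  then show "A \<subseteq> B \<or> B \<subseteq> A"
    using UV by blast
next
  fix \<A> :: "('k \<rightharpoonup> 'l) set set"
  assume "\<A> \<subseteq> final_segments \<kappa>"
  then obtain \<U> where \<U>: "\<A> = image tag ` \<U>"
    "\<U> \<subseteq> {U. U \<subseteq> Field \<kappa> \<and> (\<forall>a\<in>U. \<forall>b. (a, b) \<in> \<kappa> \<longrightarrow> b \<in> U)}"
    unfolding final_segments_def by (meson subset_imageE)
  have "\<Union>\<A> = tag ` \<Union>\<U>"
    unfolding \<U>(1) by blast
  moreover have "\<Union>\<U> \<in> {U. U \<subseteq> Field \<kappa> \<and> (\<forall>a\<in>U. \<forall>b. (a, b) \<in> \<kappa> \<longrightarrow> b \<in> U)}"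
    using \<U>(2) by blast
  ultimately show "\<Union>\<A> \<in> final_segments \<kappa>"
    unfolding final_segments_def by blast
next
  have "tag ` Field \<kappa> \<in> (final_segments \<kappa> :: ('k \<rightharpoonup> 'l) set set)"
    unfolding final_segments_def by (intro imageI) (auto simp: Field_def)
  then show "final_segments \<kappa> \<noteq> {{} :: ('k \<rightharpoonup> 'l) set}"
    using assms(2) by (metis image_is_empty singletonD)
qed

text \<open>The restriction to subsets of the space is there because the domain of a measure may
  contain no other sets.\<close>

definition thickness ::
    "'k rel \<Rightarrow> 'l rel \<Rightarrow> 'd rel \<Rightarrow> ('k \<rightharpoonup> 'l) set \<rightharpoonup> ('k \<rightharpoonup> 'l) set" where
  "thickness \<kappa> \<Lambda> \<delta> = (\<lambda>A. Some (tag ` thick \<kappa> \<delta> A)) |` Pow (seqs \<kappa> (Field \<Lambda>))"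

lemma thickness_eq:
  "A \<subseteq> seqs \<kappa> (Field \<Lambda>) \<Longrightarrow> thickness \<kappa> \<Lambda> \<delta> A = Some (tag ` thick \<kappa> \<delta> A)"
  by (simp add: thickness_def)

lemma dom_thickness: "dom (thickness \<kappa> \<Lambda> \<delta>) = Pow (seqs \<kappa> (Field \<Lambda>))"
  by (auto simp: thickness_def)

lemma tag_thick_mem: "Well_order \<kappa> \<Longrightarrow> tag ` thick \<kappa> \<delta> A \<in> final_segments \<kappa>"
  unfolding final_segments_def
  by (intro imageI CollectI conjI ballI allI impI) (blast intro: thick_upward thick_subset[THEN subsetD])+

text \<open>A nonempty open set contains a cone, and the cone is thick at its own length. This gives
  both positive total measure and full support.\<close>

lemma thick_open_nonempty:
  assumes "Well_order \<kappa>" "Field \<kappa> \<noteq> {}" "Card_order \<Lambda>" "\<delta> \<le>o \<Lambda>"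
    and "openin (bounded_topology \<kappa> \<Lambda>) U" "U \<noteq> {}"
  shows "thick \<kappa> \<delta> U \<noteq> {}"
proof -
  obtain x where x: "x \<in> U"
    using assms(6) by blast
  then obtain a where a: "a \<in> Field \<kappa>" "cone \<kappa> \<Lambda> (x |` underS \<kappa> a) \<subseteq> U"
    using openin_bounded_topology_cone[OF assms(1,2,5)] by blast
  have "x \<in> seqs \<kappa> (Field \<Lambda>)"
    using x openin_subset[OF assms(5)] topspace_bounded_topology[OF assms(2)] by blast
  then have "a \<in> thick \<kappa> \<delta> (cone \<kappa> \<Lambda> (x |` underS \<kappa> a))"
    using a(1) by (rule thick_cone[OF assms(1,3,4)])
  then show ?thesis
    using thick_mono[OF a(2)] by blast
qed

text \<open>Axiom \<open>M4\<close> bounds the order type of the index set, while stability speaks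
  of its cardinality, which is least among all well-orders on that set.\<close>

lemma ordLess_card_Restr:
  assumes "Well_order \<Omega>" "A \<subseteq> Field \<Omega>" "Restr \<Omega> A <o \<delta>"
  shows "|A| <o \<delta>"
proof -
  have "well_order_on A (Restr \<Omega> A)"
    using Well_order_Restr[OF assms(1), of A] Refl_Field_Restr2[OF _ assms(2)] assms(1)
    by (simp add: order_on_defs)
  then show ?thesis
    using card_of_least ordLeq_ordLess_trans assms(3) by blast
qed

section \<open>Verification of the axioms, continuity and full support\<close>

theorem proposition7p1:
  fixes \<kappa> :: "'k rel" and \<Lambda> :: "'l rel" and \<delta> :: "'d rel" and \<Omega> :: "'i rel"
  assumes "Cinfinite \<kappa>" "Cinfinite \<Lambda>" "\<kappa> \<le>o \<Lambda>" "regularCard \<kappa>"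
    and "Cinfinite \<delta>" "regularCard \<delta>" "\<delta> \<le>o \<Lambda>"
    and "\<delta> \<le>o \<Omega>"
  shows "\<exists>(M :: ('k \<rightharpoonup> 'l) set monoid) (L :: ('k \<rightharpoonup> 'l) set gorder) Sum \<MM> \<mu>.
    continuous_weak_measure_space M L \<Omega> Sum \<delta> (bounded_topology \<kappa> \<Lambda>) \<MM> \<mu> \<and>
    measure_support M (bounded_topology \<kappa> \<Lambda>) \<mu> = seqs \<kappa> (Field \<Lambda>)"
proof -
  let ?X = "seqs \<kappa> (Field \<Lambda>)"
  let ?T = "bounded_topology \<kappa> \<Lambda>"
  let ?S = "final_segments \<kappa> :: ('k \<rightharpoonup> 'l) set set"
  let ?\<mu> = "thickness \<kappa> \<Lambda> \<delta>"
  have \<kappa>: "Well_order \<kappa>" "Field \<kappa> \<noteq> {}" "\<not> finite (Field \<kappa>)" "Card_order \<kappa>"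
    using assms(1) by (auto simp: cinfinite_def card_order_on_def)
  have \<Omega>: "Well_order \<Omega>"
    using assms(8) by (auto simp: ordLeq_def)
  \<comment> \<open>The infinite \<delta> embeds into \<Omega>, so \<Omega> is nonempty and has room
    for the empty sequence.\<close>
  have "|Field \<delta>| \<le>o |Field \<Omega>|"
    using assms(8) by (rule card_of_mono2)
  moreover have "\<not> finite (Field \<delta>)"
    using assms(5) by (simp add: cinfinite_def)
  ultimately have \<Omega>_ne: "Field \<Omega> \<noteq> {}"
    using card_of_ordLeq_infinite by fastforce
  have \<Lambda>: "Card_order \<Lambda>" "Field \<Lambda> \<noteq> {}"
    using assms(2) by (auto simp: cinfinite_def)
  \<comment> \<open>Regularity of \<delta> enters here, in the form used for additivity.\<close>
  have stable: "stable \<delta>"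
    using assms(5,6) by (auto simp: cinfinite_def intro: regularCard_stable)
  have top: "topspace ?T = ?X"
    using \<kappa>(2) by (rule topspace_bounded_topology)
  interpret S: Union_closed_chain ?S
    using \<kappa>(1,2) by (rule Union_closed_chain_final_segments)
  interpret infinitary_sum "union_monoid ?S" "inclusion_order ?S" \<Omega> "union_sum \<Omega> ?S"
    using \<Omega> \<Omega>_ne by (rule S.infinitary_sum)
  have open_pos: "?\<mu> U \<noteq> Some {}" if "openin ?T U" "U \<noteq> {}" for U
    using thick_open_nonempty[OF \<kappa>(1,2) \<Lambda>(1) assms(7) that] openin_subset[OF that(1)] top
    by (simp add: thickness_eq)
  \<comment> \<open>A constant sequence shows that the space is a nonempty open set, hence of
    positive measure.\<close>
  obtain l where "l \<in> Field \<Lambda>"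
    using \<Lambda>(2) by blast
  then have "(\<lambda>i. if i \<in> Field \<kappa> then Some l else None) \<in> ?X"
    by (auto simp: seqs_def ran_def dom_def)
  then have X_ne: "topspace ?T \<noteq> {}"
    unfolding top by blast
  \<comment> \<open>All subsets of the space are taken as measurable, so the closure conditions and
    the measurability of points are immediate.\<close>
  have "continuous_weak_measure_space (union_monoid ?S) (inclusion_order ?S) \<Omega> (union_sum \<Omega> ?S) \<delta>
      ?T (Pow ?X) ?\<mu>"
  proof
    show "openin ?T U \<Longrightarrow> U \<in> Pow ?X" for U
      using openin_subset top by blast
    show "ran ?\<mu> \<subseteq> carrier (union_monoid ?S)"
      using tag_thick_mem[OF \<kappa>(1)] by (auto simp: thickness_def ran_def restrict_map_def)
    show "?\<mu> {} = Some \<one>\<^bsub>union_monoid ?S\<^esub>"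
      using thick_empty[OF assms(5)] by (simp add: thickness_eq)
    show "\<one>\<^bsub>union_monoid ?S\<^esub> \<sqsubset>\<^bsub>inclusion_order ?S\<^esub> the (?\<mu> (topspace ?T))"
      using open_pos[OF openin_topspace X_ne] by (auto simp: lless_eq top thickness_eq)
    show "the (?\<mu> A) \<sqsubseteq>\<^bsub>inclusion_order ?S\<^esub> the (?\<mu> B)"
      if "A \<in> Pow ?X" "B \<in> Pow ?X" "A \<subseteq> B" for A B
      using that image_mono[OF thick_mono[OF that(3)]] by (simp add: thickness_eq)
  next
    fix g and F :: "'i \<Rightarrow> ('k \<rightharpoonup> 'l) set"
    assume g: "g \<in> Field \<Omega>" "Restr \<Omega> (underS \<Omega> g) <o \<delta>"
      and F: "\<forall>i\<in>underS \<Omega> g. F i \<in> Pow ?X"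
    let ?s = "(?\<mu> \<circ> F) |` underS \<Omega> g"
    have ran: "ran ?s = (\<lambda>i. tag ` thick \<kappa> \<delta> (F i)) ` underS \<Omega> g"
      using F by (force simp: ran_def restrict_map_def thickness_eq split: if_splits)
    have "dom ?s = underS \<Omega> g"
      using F by (auto simp: dom_def restrict_map_def thickness_eq)
    then have s: "?s \<in> seqs_below \<Omega> ?S"
      using g(1) ran tag_thick_mem[OF \<kappa>(1)] by (auto simp: seqs_below_def)
    have "|underS \<Omega> g| <o \<delta>"
      by (rule ordLess_card_Restr[OF \<Omega> _ g(2)]) (auto simp: underS_def Field_def)
    then have "thick \<kappa> \<delta> (\<Union>i\<in>underS \<Omega> g. F i) = (\<Union>i\<in>underS \<Omega> g. thick \<kappa> \<delta> (F i))"
      by (rule thick_UNION[OF stable])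
    \<comment> \<open>Direct images under \<open>tag\<close> preserve unions, so the equation
      carries over to the encoded values.\<close>
    then have "?\<mu> (\<Union>i\<in>underS \<Omega> g. F i) = Some (\<Union>i\<in>underS \<Omega> g. tag ` thick \<kappa> \<delta> (F i))"
      using F by (subst thickness_eq) (auto simp: image_UN)
    also have "\<dots> = union_sum \<Omega> ?S ?s"
      unfolding union_sum_eq[OF s] ran ..
    finally show "?s \<in> dom (union_sum \<Omega> ?S) \<and>
        ?\<mu> (\<Union>i\<in>underS \<Omega> g. F i) = union_sum \<Omega> ?S ?s"
      unfolding dom_union_sum using s by (rule conjI[rotated])
  next
    fix x \<B>
    assume x: "x \<in> topspace ?T" and \<B>: "open_local_basis ?T x \<B>"
    have \<B>_X: "B \<subseteq> ?X" if "B \<in> \<B>" for B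
      unfolding top[symmetric] using \<B> that
      by (intro openin_subset) (simp add: open_local_basis_def)
    \<comment> \<open>For \<open>M5\<close>: the values along a local basis have no index in common,
      because each a is eventually left out.\<close>
    have small: "\<exists>B\<in>\<B>. a \<notin> thick \<kappa> \<delta> B" if a: "a \<in> Field \<kappa>" for a
    proof -
      \<comment> \<open>An infinite cardinal has no last element. A strictly larger b is chosen so
        that \<open>underS\<close> of b contains all of \<open>under\<close> of a, and points of the
        cone agree up to and including a.\<close>
      obtain b where b: "b \<in> Field \<kappa>" "(a, b) \<in> \<kappa>" "a \<noteq> b"
        using infinite_Card_order_limit[OF \<kappa>(4,3) a] by blast
      let ?C = "cone \<kappa> \<Lambda> (x |` underS \<kappa> b)"
      have "openin ?T ?C" "x \<in> ?C"
        using x b(1) unfolding top by (simp_all add: openin_cone mem_cone)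
      then obtain B where B: "B \<in> \<B>" "B \<subseteq> ?C"
        using \<B> unfolding open_local_basis_def by meson
      have sub: "under \<kappa> a \<subseteq> underS \<kappa> b"
        using b \<kappa>(1) by (auto simp: under_def underS_def order_on_defs dest: transD antisymD)
      have dom: "underS \<kappa> b \<subseteq> dom x"
        using x top by (auto simp: seqs_def underS_def Field_def)
      have "y |` under \<kappa> a = x |` under \<kappa> a" if "y \<in> B" for y
      proof -
        have le: "x |` underS \<kappa> b \<subseteq>\<^sub>m y"
          using that B(2) by (auto simp: cone_def)
        have "x i = y i" if "i \<in> under \<kappa> a" for i
          using le that sub dom unfolding map_le_def dom_restrict
          by (metis IntI restrict_in subsetD)
        then show ?thesis
          by (auto simp: restrict_map_def)
      qed
      then have "a \<notin> thick \<kappa> \<delta> B"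
        by (rule thick_eq_image_singleton[OF assms(5)])
      then show ?thesis
        using B(1) by blast
    qed
    \<comment> \<open>A lower bound is itself the image of a set of indices. Injectivity of
      \<open>tag\<close> puts these indices into every thick set along the basis, and
      \<open>small\<close> excludes each of them.\<close>
    have zero: "C = {}" if C: "C \<in> ?S" "\<And>B. B \<in> \<B> \<Longrightarrow> C \<subseteq> tag ` thick \<kappa> \<delta> B" for C
    proof -
      obtain U where U: "U \<subseteq> Field \<kappa>" "C = tag ` U"
        using C(1) by (auto simp: final_segments_def)
      have "U \<subseteq> thick \<kappa> \<delta> B" if "B \<in> \<B>" for B
        using C(2)[OF that] by (simp add: U(2) inj_image_subset_iff[OF inj_tag])
      then have "U = {}"
        using small U(1) by blast
      then show ?thesis
        using U(2) by simp
    qed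
    have "{the (?\<mu> B) | B. B \<in> \<B>} = {tag ` thick \<kappa> \<delta> B | B. B \<in> \<B>}"
      using \<B>_X by (simp add: thickness_eq cong: rev_conj_cong)
    \<comment> \<open>\<open>Lower\<close> compares only with members of the carrier, so the values
      must be known to lie in it.\<close>
    moreover have "tag ` thick \<kappa> \<delta> B \<in> ?S" for B :: "('k \<rightharpoonup> 'l) set"
      using \<kappa>(1) by (rule tag_thick_mem)
    ultimately have "Lower (inclusion_order ?S) {the (?\<mu> B) | B. B \<in> \<B>} =
        {C \<in> ?S. \<forall>B\<in>\<B>. C \<subseteq> tag ` thick \<kappa> \<delta> B}"
      unfolding Lower_def by auto
    also have "\<dots> = {{}}"
      using zero S.empty_mem by blast
    finally have "Lower (inclusion_order ?S) {the (?\<mu> B) | B. B \<in> \<B>} = {{}}" .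
    moreover have "?\<mu> {x} = Some {}"
      using x thick_singleton[OF assms(5)] by (simp add: top thickness_eq)
    ultimately show "greatest (inclusion_order ?S) (the (?\<mu> {x}))
        (Lower (inclusion_order ?S) {the (?\<mu> B) | B. B \<in> \<B>})"
      using S.empty_mem by (simp add: greatest_def)
  next
    show "x \<in> topspace ?T \<Longrightarrow> {x} \<in> Pow ?X \<and> ?\<mu> {x} = Some \<one>\<^bsub>union_monoid ?S\<^esub>" for x
      using thick_singleton[OF assms(5)] by (simp add: top thickness_eq)
  qed (use assms(8) in \<open>auto simp: dom_thickness top\<close>)
  \<comment> \<open>The only open null set is the empty one, so nothing is removed from the
    space.\<close>
  moreover have "measure_support (union_monoid ?S) ?T ?\<mu> = ?X"
    using open_pos top by (auto simp: measure_support_def)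
  ultimately show ?thesis
    by (intro exI conjI)
qed

end
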